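(* Let $k$ be a field of characteristic $\ne 2$ with $u(k) < \infty$, and let $i, j \geq 1$ be integers. Then \[\max\{1, m(k) + 2j - 1 - i\} \leq m_{i,j}(k) \leq \max\{1, u(k) + 2j - 1 - i\}.\] Moreover, if either $u(k) + 2j - 1 - i \leq 1$ or $m(k) = u(k)$, then both inequalities are equalities.
   Context: All quadratic forms are regular; $i_W(q)$ is the Witt index of $q$. $u(k)$ is the maximal dimension of an anisotropic quadratic form over $k$. The $m$-invariant $m(k)$ is the minimal dimension of an anisotropic universal quadratic form over $k$ (a form is universal if it represents every element of $k^\times$); it equals $m_{1,1}(k)$. For integers $i,j\ge1$, $m_{i,j}(k)$ is the infimum of $\dim q \ge 1$ over quadratic forms $q$ over $k$ such that $i_W(q) < j$ and $i_W(q \perp \sigma_i) \geq j$ for every $i$-dimensional quadratic form $\sigma_i$ over $k$, with the infimum of the empty set equal to $\infty$. *)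

theory Defs
  imports "Jordan_Normal_Form.Determinant" "HOL-Library.Extended_Real"
begin

text \<open>
  In characteristic different from 2, an \<open>n\<close>-ary quadratic form is the same thing as its symmetric
  Gram matrix \<open>A\<close>, the form being \<open>v \<mapsto> v\<^sup>T A v\<close> on \<open>k\<^sup>n\<close>. It is regular iff \<open>A\<close> is nonsingular.
  The zero form on \<open>k\<^sup>0\<close> (the \<open>0 \<times> 0\<close> matrix) is regular and anisotropic.
\<close>

definition regular_form :: "nat \<Rightarrow> 'a::field mat \<Rightarrow> bool" where
  "regular_form n A \<longleftrightarrow> A \<in> carrier_mat n n \<and> transpose_mat A = A \<and> det A \<noteq> 0"

definition form_value :: "'a::field mat \<Rightarrow> 'a vec \<Rightarrow> 'a" where
  "form_value A v = v \<bullet> (A *\<^sub>v v)"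

definition anisotropic :: "'a::field mat \<Rightarrow> bool" where
  "anisotropic A \<longleftrightarrow>
     (\<forall>v \<in> carrier_vec (dim_row A). form_value A v = 0 \<longrightarrow> v = 0\<^sub>v (dim_row A))"

definition universal :: "'a::field mat \<Rightarrow> bool" where
  "universal A \<longleftrightarrow> (\<forall>a. a \<noteq> 0 \<longrightarrow> (\<exists>v \<in> carrier_vec (dim_row A). form_value A v = a))"

definition isometric :: "'a::field mat \<Rightarrow> 'a mat \<Rightarrow> bool" where
  "isometric A B \<longleftrightarrow>
     (\<exists>P \<in> carrier_mat (dim_row A) (dim_row A). det P \<noteq> 0 \<and> B = transpose_mat P * A * P)"

definition orth_sum :: "'a::field mat \<Rightarrow> 'a mat \<Rightarrow> 'a mat" where
  "orth_sum A B = diag_block_mat [A, B]"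

text \<open>The hyperbolic plane \<open>\<langle>1, -1\<rangle>\<close>.\<close>

definition hyperbolic_plane :: "'a::field mat" where
  "hyperbolic_plane = mat_of_rows_list 2 [[1, 0], [0, -1]]"

text \<open>
  The Witt index of a regular form \<open>A\<close> is the number \<open>m\<close> of hyperbolic planes in its Witt
  decomposition \<open>A \<cong> m \<times> \<langle>1, -1\<rangle> \<bottom> B\<close> with \<open>B\<close> anisotropic. In characteristic different from 2
  it exists and is unique by Witt's theorems; \<open>A\<close> itself is required to be regular wherever
  the Witt index is used.
\<close>

definition witt_index :: "'a::field mat \<Rightarrow> nat" where
  "witt_index A =
     (THE m. \<exists>n B. regular_form n B \<and> anisotropic B \<and>
        isometric A (diag_block_mat (replicate m hyperbolic_plane @ [B])))"

text \<open>
  The invariants take values in \<open>enat\<close>, where the infimum of the empty set is \<open>\<infinity>\<close>. The argument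
  \<open>k\<close> only carries the field \<open>'a\<close>.
\<close>

definition u_invariant :: "'a::field itself \<Rightarrow> enat" where
  "u_invariant k = Sup {enat n | n. \<exists>A :: 'a mat. regular_form n A \<and> anisotropic A}"

definition m_invariant :: "'a::field itself \<Rightarrow> enat" where
  "m_invariant k = Inf {enat n | n. \<exists>A :: 'a mat. regular_form n A \<and> anisotropic A \<and> universal A}"

definition general_m_invariant :: "'a::field itself \<Rightarrow> nat \<Rightarrow> nat \<Rightarrow> enat" where
  "general_m_invariant k i j = Inf {enat n | n. n \<ge> 1 \<and>
     (\<exists>A :: 'a mat. regular_form n A \<and> witt_index A < j \<and>
        (\<forall>S :: 'a mat. regular_form i S \<longrightarrow> witt_index (orth_sum A S) \<ge> j))}"

end

theory Submission
  imports Defs "Jordan_Normal_Form.DL_Rank" "Jordan_Normal_Form.Schur_Decomposition"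
begin

text \<open>
  Upper bound: adding any \<open>i\<close>-dimensional form to a form of dimension \<open>n \<ge> u + 2 j - 1 - i\<close> gives
  dimension at least \<open>u + 2 j - 1\<close>, so the anisotropic part, of dimension at most \<open>u\<close>, leaves room
  for \<open>j\<close> hyperbolic planes; and a form of the extremal dimension with Witt index below \<open>j\<close> is an
  anisotropic form plus at most \<open>j - 1\<close> hyperbolic planes.

  Lower bound: adding a unary form \<open>\<langle>a\<rangle>\<close>, with \<open>a\<close> suitably chosen, raises the Witt index by at most
  one. Once the index is \<open>j - 1\<close> and the anisotropic part has dimension below \<open>m\<close>, that part misses
  some nonzero \<open>-a\<close>, and adding \<open>\<langle>a\<rangle>\<close> keeps the index at \<open>j - 1\<close>. Iterating \<open>i\<close> times shows that
  \<open>m + 2 j - 1 \<le> n + i\<close> for every admissible dimension \<open>n\<close>.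
\<close>

section \<open>Isometries and orthogonal sums\<close>

abbreviation symmetric_form :: "nat \<Rightarrow> 'a::field mat \<Rightarrow> bool" where
  "symmetric_form n A \<equiv> A \<in> carrier_mat n n \<and> transpose_mat A = A"

section \<open>Values of a symmetric form and its bilinear form\<close>

lemma bilinear_comm:
  assumes "symmetric_form n A" "v \<in> carrier_vec n" "w \<in> carrier_vec n"
  shows "v \<bullet> (A *\<^sub>v w) = w \<bullet> (A *\<^sub>v v)"
  using transpose_vec_mult_scalar[of A n n w v] assms comm_scalar_prod[of "A *\<^sub>v v" n w] by auto

lemma form_value_add:
  assumes "symmetric_form n A" "v \<in> carrier_vec n" "w \<in> carrier_vec n"
  shows "form_value A (v + w) = form_value A v + form_value A w + 2 * (v \<bullet> (A *\<^sub>v w))"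
proof -
  have "form_value A (v + w) = v \<bullet> (A *\<^sub>v v) + v \<bullet> (A *\<^sub>v w) + (w \<bullet> (A *\<^sub>v v) + w \<bullet> (A *\<^sub>v w))"
    unfolding form_value_def using assms mult_mat_vec_carrier[of A n n]
    by (simp add: mult_add_distrib_mat_vec[of A n n] add_scalar_prod_distrib[of _ n]
        scalar_prod_add_distrib[of _ n] add_scalar_prod_distrib[of _ n _ "A *\<^sub>v _"])
  then show ?thesis using bilinear_comm[OF assms] by (simp add: form_value_def)
qed

lemma form_value_smult:
  assumes "A \<in> carrier_mat n n" "v \<in> carrier_vec n"
  shows "form_value A (c \<cdot>\<^sub>v v) = c\<^sup>2 * form_value A v"
  unfolding form_value_def using assms
  by (simp add: mult_mat_vec[of A n n] power2_eq_square)

lemma form_value_zero: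
  assumes "A \<in> carrier_mat n n"
  shows "form_value A (0\<^sub>v n) = 0"
  using assms by (simp add: form_value_def scalar_prod_def)

lemma form_value_congruence:
  assumes "A \<in> carrier_mat n n" "P \<in> carrier_mat n m" "v \<in> carrier_vec m"
  shows "form_value (transpose_mat P * A * P) v = form_value A (P *\<^sub>v v)"
proof -
  have "transpose_mat P * A * P *\<^sub>v v = transpose_mat P *\<^sub>v (A *\<^sub>v (P *\<^sub>v v))"
    using assms by (simp add: assoc_mult_mat_vec[of _ m n _ m] assoc_mult_mat_vec[of _ n n _ m]
        assoc_mult_mat_vec[of _ m n _ n] del: assoc_mult_mat)
  moreover have "v \<bullet> (transpose_mat P *\<^sub>v (A *\<^sub>v (P *\<^sub>v v))) = (P *\<^sub>v v) \<bullet> (A *\<^sub>v (P *\<^sub>v v))"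
    using transpose_vec_mult_scalar[of P n m v "A *\<^sub>v (P *\<^sub>v v)"] assms
    by (metis comm_scalar_prod mult_mat_vec_carrier transpose_carrier_mat)
  ultimately show ?thesis by (simp add: form_value_def)
qed

lemma symmetric_congruence:
  assumes "symmetric_form n A" "P \<in> carrier_mat n m"
  shows "symmetric_form m (transpose_mat P * A * P)"
proof
  show "transpose_mat P * A * P \<in> carrier_mat m m" using assms by (auto intro!: mult_carrier_mat)
  have "transpose_mat (transpose_mat P * A * P)
      = transpose_mat P * (transpose_mat A * transpose_mat (transpose_mat P))"
    using assms transpose_mult[of "transpose_mat P * A" m n P m] transpose_mult[of "transpose_mat P" m n A n]
    by (metis mult_carrier_mat transpose_carrier_mat)
  then show "transpose_mat (transpose_mat P * A * P) = transpose_mat P * A * P"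
    using assms by (simp add: assoc_mult_mat[of _ m n _ n _ m])
qed

text \<open>Polarization: twice the entry at (i, j) is q(e_i + e_j) - q(e_i) - q(e_j), and 2 can be
  cancelled.\<close>

lemma symmetric_form_eqI:
  fixes A B :: "'a::field mat"
  assumes two: "(2::'a) \<noteq> 0" and A: "symmetric_form n A" and B: "symmetric_form n B"
    and eq: "\<And>v. v \<in> carrier_vec n \<Longrightarrow> form_value A v = form_value B v"
  shows "A = B"
proof (rule eq_matI)
  fix i j assume ij: "i < dim_row B" "j < dim_col B"
  then have ij: "i < n" "j < n" using B by auto
  have entry: "C $$ (i, j) = unit_vec n i \<bullet> (C *\<^sub>v unit_vec n j)" if "C \<in> carrier_mat n n" for C :: "'a mat"
    using that ij by (simp add: scalar_prod_left_unit[of _ n])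
  have "form_value A (unit_vec n i + unit_vec n j) = form_value B (unit_vec n i + unit_vec n j)"
    "form_value A (unit_vec n i) = form_value B (unit_vec n i)"
    "form_value A (unit_vec n j) = form_value B (unit_vec n j)"
    by (auto intro!: eq)
  then have "2 * (unit_vec n i \<bullet> (A *\<^sub>v unit_vec n j)) = 2 * (unit_vec n i \<bullet> (B *\<^sub>v unit_vec n j))"
    using form_value_add[OF A, of "unit_vec n i" "unit_vec n j"]
      form_value_add[OF B, of "unit_vec n i" "unit_vec n j"] by (metis add_left_cancel unit_vec_carrier)
  then have "unit_vec n i \<bullet> (A *\<^sub>v unit_vec n j) = unit_vec n i \<bullet> (B *\<^sub>v unit_vec n j)"
    using two by (metis mult_left_cancel)
  then show "A $$ (i, j) = B $$ (i, j)" using entry[of A] entry[of B] A B by metis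
qed (use A B in auto)

text \<open>By polarization, a matrix identity between symmetric forms can be checked on values, so
  later isometries are verified vector by vector.\<close>

lemma congruence_eqI:
  fixes A B :: "'a::field mat"
  assumes "(2::'a) \<noteq> 0" and A: "symmetric_form n A" and "symmetric_form n B"
    and P: "P \<in> carrier_mat n n"
    and eq: "\<And>v. v \<in> carrier_vec n \<Longrightarrow> form_value A (P *\<^sub>v v) = form_value B v"
  shows "B = transpose_mat P * A * P"
  using assms symmetric_congruence[OF A P] A P
  by (intro symmetric_form_eqI[where n = n]) (auto simp: form_value_congruence[of _ n] simp del: assoc_mult_mat)

lemma isometricI:
  fixes A B :: "'a::field mat"
  assumes "(2::'a) \<noteq> 0" and "symmetric_form n A" and "symmetric_form n B"
    and "P \<in> carrier_mat n n" "det P \<noteq> 0"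
    and "\<And>v. v \<in> carrier_vec n \<Longrightarrow> form_value A (P *\<^sub>v v) = form_value B v"
  shows "isometric A B"
  using assms congruence_eqI[OF assms(1-4,6)] unfolding isometric_def by (intro bexI[of _ P]) auto

lemma det_congruence:
  fixes A P :: "'a::field mat"
  assumes "A \<in> carrier_mat n n" "P \<in> carrier_mat n n"
  shows "det (transpose_mat P * A * P) = det P * det A * det P"
  using assms det_mult[of "transpose_mat P * A" n P] det_mult[of "transpose_mat P" n A] det_transpose[of P n]
  by (metis mult_carrier_mat transpose_carrier_mat)

text \<open>Determinants of \<open>B = transpose_mat P * A * P\<close> give det B = (det P)^2 det A.
  As det B is nonzero, a value-preserving \<open>P\<close> between regular forms of equal dimension
  is automatically invertible.\<close>

lemma isometric_regularI:
  fixes A B :: "'a::field mat"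
  assumes two: "(2::'a) \<noteq> 0" and A: "regular_form n A" and B: "regular_form n B"
    and P: "P \<in> carrier_mat n n"
    and eq: "\<And>v. v \<in> carrier_vec n \<Longrightarrow> form_value A (P *\<^sub>v v) = form_value B v"
  shows "isometric A B"
proof (rule isometricI[OF two _ _ P _ eq])
  have "B = transpose_mat P * A * P"
    using A B by (intro congruence_eqI[OF two _ _ P eq]) (auto simp: regular_form_def)
  then have "det P * det A * det P = det B"
    using P A by (metis det_congruence regular_form_def)
  then show "det P \<noteq> 0" using B by (auto simp: regular_form_def)
qed (use A B in \<open>auto simp: regular_form_def\<close>)

section \<open>Isometry as an equivalence relation on regular forms\<close>

lemma isometricE:
  assumes "isometric A B" "regular_form n A"
  obtains P where "P \<in> carrier_mat n n" "det P \<noteq> 0" "B = transpose_mat P * A * P"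
    "\<And>v. v \<in> carrier_vec n \<Longrightarrow> form_value A (P *\<^sub>v v) = form_value B v"
  using assms unfolding isometric_def regular_form_def
  by (metis carrier_matD(1) form_value_congruence)

lemma regular_isometric:
  assumes "isometric A B" "regular_form n A"
  shows "regular_form n B"
proof -
  obtain P where P: "P \<in> carrier_mat n n" "det P \<noteq> 0" and B: "B = transpose_mat P * A * P"
    using isometricE[OF assms] by metis
  have "det B = det P * det A * det P"
    using P(1) assms(2) B by (metis det_congruence regular_form_def)
  then show ?thesis using symmetric_congruence[of A n P n] P assms(2)
    by (auto simp: B regular_form_def simp del: assoc_mult_mat)
qed

lemma isometric_refl:
  fixes A :: "'a::field mat"
  assumes "regular_form n A" shows "isometric A A"
  using assms unfolding isometric_def regular_form_def by (intro bexI[of _ "1\<^sub>m n"]) auto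

lemma isometric_trans:
  assumes "isometric A B" "isometric B C" "regular_form n A"
  shows "isometric A C"
proof -
  obtain P where P: "P \<in> carrier_mat n n" "det P \<noteq> 0" "B = transpose_mat P * A * P"
    using isometricE[OF assms(1,3)] by metis
  obtain Q where Q: "Q \<in> carrier_mat n n" "det Q \<noteq> 0" "C = transpose_mat Q * B * Q"
    using isometricE[OF assms(2) regular_isometric[OF assms(1,3)]] by metis
  have A: "A \<in> carrier_mat n n" using assms(3) by (auto simp: regular_form_def)
  have "C = transpose_mat (P * Q) * A * (P * Q)"
    using P Q A by (simp add: transpose_mult[of _ n n] assoc_mult_mat[of _ n n _ n _ n])
  then show ?thesis using P Q A unfolding isometric_def
    by (intro bexI[of _ "P * Q"]) (auto simp: det_mult[of _ n])
qed

lemma isometric_sym: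
  assumes "isometric A B" "regular_form n A"
  shows "isometric B A"
proof -
  obtain P where P: "P \<in> carrier_mat n n" "det P \<noteq> 0" "B = transpose_mat P * A * P"
    using isometricE[OF assms] by metis
  \<comment> \<open>The argument \<open>undefined\<close> fills the extension slot of the record
    \<open>ring_mat\<close>; the inverse \<open>Q\<close> is read off from membership in its group
    of units.\<close>
  from det_non_zero_imp_unit[OF P(1,2), of undefined]
  obtain Q where Q: "Q \<in> carrier_mat n n" "P * Q = 1\<^sub>m n"
    unfolding Units_def by (auto simp: ring_mat_def)
  have A: "A \<in> carrier_mat n n" using assms(2) by (auto simp: regular_form_def)
  have "transpose_mat Q * transpose_mat P = 1\<^sub>m n"
    using P(1) Q transpose_mult[of P n n Q n] by (metis transpose_one)
  moreover have "transpose_mat Q * B * Q = (transpose_mat Q * transpose_mat P) * A * (P * Q)"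
    using P Q A by (simp add: assoc_mult_mat[of _ n n _ n _ n])
  ultimately have eq: "A = transpose_mat Q * B * Q" using Q A by simp
  have "det P * det Q = 1" using P(1) Q det_mult[of P n Q] by simp
  then have "det Q \<noteq> 0" by auto
  moreover have "dim_row B = n" using P A by simp
  ultimately show ?thesis unfolding isometric_def using eq Q by auto
qed

section \<open>Orthogonal sums as block matrices\<close>

lemma orth_sum_four_block:
  "orth_sum A B = four_block_mat A (0\<^sub>m (dim_row A) (dim_col B)) (0\<^sub>m (dim_row B) (dim_col A)) B"
  unfolding orth_sum_def diag_block_mat.simps(2)[of A] diag_block_mat_singleton Let_def ..

text \<open>For Gram matrices this is an equality, not just an isometry, so summands can be
  regrouped by rewriting.\<close>

lemma orth_sum_assoc: "orth_sum (orth_sum A B) C = orth_sum A (orth_sum B C)"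
  unfolding orth_sum_four_block by (rule assoc_four_block_mat[symmetric])

lemma regular_orth_sum:
  assumes "regular_form n A" "regular_form m B"
  shows "regular_form (n + m) (orth_sum A B)"
  using assms unfolding regular_form_def orth_sum_four_block
  by (auto simp: transpose_four_block_mat[of _ n n _ m _ m] det_four_block_mat_lower_left_zero[of _ n _ m])

lemma form_value_orth_sum:
  assumes "A \<in> carrier_mat n n" "B \<in> carrier_mat m m" "v \<in> carrier_vec n" "w \<in> carrier_vec m"
  shows "form_value (orth_sum A B) (v @\<^sub>v w) = form_value A v + form_value B w"
proof -
  have "orth_sum A B *\<^sub>v (v @\<^sub>v w) = A *\<^sub>v v @\<^sub>v B *\<^sub>v w"
    using mult_mat_vec_split[OF assms] assms by (simp add: orth_sum_four_block)
  then show ?thesis using assms by (simp add: form_value_def scalar_prod_append[of _ n _ m])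
qed

lemma append_vecE:
  assumes "v \<in> carrier_vec (n + m)"
  obtains x y where "x \<in> carrier_vec n" "y \<in> carrier_vec m" "v = x @\<^sub>v y"
  using vec_first_last_append[OF assms] by (metis vec_first_carrier vec_last_carrier)

lemma isometric_orth_sum:
  fixes A A' B B' :: "'a::field mat"
  assumes two: "(2::'a) \<noteq> 0" and reg: "regular_form n A" "regular_form m B"
    and iso: "isometric A A'" "isometric B B'"
  shows "isometric (orth_sum A B) (orth_sum A' B')"
proof -
  obtain P where P: "P \<in> carrier_mat n n" "\<And>v. v \<in> carrier_vec n \<Longrightarrow> form_value A (P *\<^sub>v v) = form_value A' v"
    using isometricE[OF iso(1) reg(1)] by metis
  obtain Q where Q: "Q \<in> carrier_mat m m" "\<And>v. v \<in> carrier_vec m \<Longrightarrow> form_value B (Q *\<^sub>v v) = form_value B' v"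
    using isometricE[OF iso(2) reg(2)] by metis
  have reg': "regular_form n A'" "regular_form m B'" using iso reg regular_isometric by blast+
  then have c: "A \<in> carrier_mat n n" "B \<in> carrier_mat m m" "A' \<in> carrier_mat n n" "B' \<in> carrier_mat m m"
    using reg by (auto simp: regular_form_def)
  show ?thesis
  proof (rule isometric_regularI[OF two regular_orth_sum[OF reg] regular_orth_sum[OF reg']])
    show "four_block_mat P (0\<^sub>m n m) (0\<^sub>m m n) Q \<in> carrier_mat (n + m) (n + m)" using P Q by auto
    fix v :: "'a vec" assume "v \<in> carrier_vec (n + m)"
    then obtain x y where v: "x \<in> carrier_vec n" "y \<in> carrier_vec m" "v = x @\<^sub>v y" by (rule append_vecE)
    then show "form_value (orth_sum A B) (four_block_mat P (0\<^sub>m n m) (0\<^sub>m m n) Q *\<^sub>v v)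
        = form_value (orth_sum A' B') v"
      using P Q c by (simp add: mult_mat_vec_split[of _ n _ m] form_value_orth_sum[of _ n _ m])
  qed
qed

text \<open>The block permutation matrix that exchanges the two groups of coordinates preserves
  values.\<close>

lemma isometric_orth_sum_comm:
  fixes A B :: "'a::field mat"
  assumes two: "(2::'a) \<noteq> 0" and reg: "regular_form n A" "regular_form m B"
  shows "isometric (orth_sum A B) (orth_sum B A)"
proof -
  let ?P = "four_block_mat (0\<^sub>m n m) (1\<^sub>m n) (1\<^sub>m m) (0\<^sub>m m n) :: 'a mat"
  have c: "A \<in> carrier_mat n n" "B \<in> carrier_mat m m" using reg by (auto simp: regular_form_def)
  have "regular_form (n + m) (orth_sum B A)" using regular_orth_sum[OF reg(2,1)] by (simp add: add.commute)
  then show ?thesis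
  proof (rule isometric_regularI[OF two regular_orth_sum[OF reg]])
    have "?P \<in> carrier_mat (n + m) (m + n)" by (rule four_block_carrier_mat) auto
    then show "?P \<in> carrier_mat (n + m) (n + m)" by (simp add: add.commute)
    fix v :: "'a vec" assume "v \<in> carrier_vec (n + m)"
    then have "v \<in> carrier_vec (m + n)" by (simp add: add.commute)
    then obtain x y where v: "x \<in> carrier_vec m" "y \<in> carrier_vec n" "v = x @\<^sub>v y" by (rule append_vecE)
    moreover from v have "0\<^sub>m n m *\<^sub>v x = 0\<^sub>v n" "0\<^sub>m m n *\<^sub>v y = 0\<^sub>v m" by auto
    ultimately have "?P *\<^sub>v v = y @\<^sub>v x"
      by (simp add: four_block_mat_mult_vec[of _ n m _ n _ m])
    then show "form_value (orth_sum A B) (?P *\<^sub>v v) = form_value (orth_sum B A) v"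
      using v c by (simp add: form_value_orth_sum[of _ n _ m] form_value_orth_sum[of _ m _ n])
  qed
qed

section \<open>Splitting off values and Witt cancellation\<close>

definition unary_form :: "'a::field \<Rightarrow> 'a mat" where
  "unary_form a = mat 1 1 (\<lambda>_. a)"

lemma unary_form_carrier: "unary_form a \<in> carrier_mat 1 1"
  by (simp add: unary_form_def)

lemma regular_unary_form: "a \<noteq> 0 \<Longrightarrow> regular_form 1 (unary_form a)"
  unfolding regular_form_def unary_form_def by (auto simp: det_single)

lemma form_value_unary_form:
  "v \<in> carrier_vec 1 \<Longrightarrow> form_value (unary_form a) v = a * (v $ 0)\<^sup>2"
  by (auto simp: form_value_def unary_form_def scalar_prod_def power2_eq_square)

lemma regular_form_carrier: "regular_form n A \<Longrightarrow> A \<in> carrier_mat n n"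
  by (simp add: regular_form_def)

text \<open>Meant for the remainder of a Schur complement, which is first obtained only as a square
  matrix: its determinant divides that of the sum, and its symmetry is read off from the lower right
  block.\<close>

lemma regular_orth_sumD:
  assumes "regular_form (n + m) (orth_sum A B)" and A: "A \<in> carrier_mat n n" and B: "B \<in> carrier_mat m m"
  shows "regular_form m B"
proof -
  have eq: "orth_sum A B = four_block_mat A (0\<^sub>m n m) (0\<^sub>m m n) B"
    using A B by (simp add: orth_sum_four_block)
  then have "det B \<noteq> 0"
    using assms det_four_block_mat_lower_left_zero[OF A _ refl B, of "0\<^sub>m n m"]
    by (auto simp: regular_form_def)
  moreover have "transpose_mat B = B"
  proof (rule eq_matI)
    fix i j assume ij: "i < dim_row B" "j < dim_col B"
    have "orth_sum A B $$ (n + i, n + j) = orth_sum A B $$ (n + j, n + i)"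
      using assms(1) ij B unfolding regular_form_def
      by (metis add_less_cancel_left carrier_matD index_transpose_mat(1))
    then show "transpose_mat B $$ (i, j) = B $$ (i, j)" using ij A B by (simp add: eq)
  qed (use B in auto)
  ultimately show ?thesis using B by (simp add: regular_form_def)
qed

text \<open>One step of symmetric Gaussian elimination with pivot \<open>a\<close>: the
  unitriangular \<open>L\<close> with upper right block -W/a clears the rest of the first row and
  column, leaving E - W^T W / a.\<close>

lemma schur_complement:
  fixes C :: "'a::field mat"
  assumes C: "symmetric_form (Suc m) C" and a: "C $$ (0, 0) = a" "a \<noteq> 0"
  shows "\<exists>D \<in> carrier_mat m m. isometric C (orth_sum (unary_form a) D)"
proof -
  define W where "W = mat 1 m (\<lambda>(i, j). C $$ (0, Suc j))"
  define E where "E = mat m m (\<lambda>(i, j). C $$ (Suc i, Suc j))"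
  define r where "r = (- 1 / a) \<cdot>\<^sub>m W"
  define D where "D = transpose_mat W * r + E"
  define L where "L = four_block_mat (1\<^sub>m 1) r (0\<^sub>m m 1) (1\<^sub>m m)"
  have W: "W \<in> carrier_mat 1 m" and E: "E \<in> carrier_mat m m" and r: "r \<in> carrier_mat 1 m"
    by (auto simp: W_def E_def r_def)
  then have D: "D \<in> carrier_mat m m" by (auto simp: D_def)
  have sym: "C $$ (i, 0) = C $$ (0, i)" if "i < Suc m" for i
    using C that by (metis carrier_matD index_transpose_mat(1) zero_less_Suc)
  have Ceq: "C = four_block_mat (unary_form a) W (transpose_mat W) E"
  proof (rule eq_matI)
    fix i j assume "i < dim_row (four_block_mat (unary_form a) W (transpose_mat W) E)"
      "j < dim_col (four_block_mat (unary_form a) W (transpose_mat W) E)"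
    then have ij: "i < Suc m" "j < Suc m" by (auto simp: unary_form_def E_def)
    show "C $$ (i, j) = four_block_mat (unary_form a) W (transpose_mat W) E $$ (i, j)"
      using ij a(1) sym[of i] by (cases i; cases j) (simp_all add: unary_form_def W_def E_def)
  qed (use C in \<open>auto simp: unary_form_def E_def\<close>)
  have ar: "unary_form a * r + W = 0\<^sub>m 1 m"
    using a by (intro eq_matI) (auto simp: unary_form_def W_def r_def scalar_prod_def)
  then have "transpose_mat (unary_form a * r + W) = 0\<^sub>m m 1" by simp
  moreover have "transpose_mat (unary_form a) = unary_form a"
    by (auto simp: unary_form_def)
  ultimately have ra: "transpose_mat r * unary_form a + transpose_mat W = 0\<^sub>m m 1"
    using r W unary_form_carrier[of a] transpose_add[of "unary_form a * r" 1 m W]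
    by (simp add: transpose_mult[of _ 1 1 _ m])
  \<comment> \<open>Multiplying by \<open>L\<close> on the right clears the first row; the transpose
    of \<open>L\<close> on the left then clears the first column and leaves \<open>D\<close>
    unchanged.\<close>
  have CL: "C * L = four_block_mat (unary_form a) (0\<^sub>m 1 m) (transpose_mat W) D"
    unfolding Ceq L_def D_def
    by (subst mult_four_block_mat[of _ 1 1 _ m _ m])
      (use W E r unary_form_carrier[of a] ar in auto)
  have LT: "transpose_mat L = four_block_mat (1\<^sub>m 1) (0\<^sub>m 1 m) (transpose_mat r) (1\<^sub>m m)"
    unfolding L_def using r by (simp add: transpose_four_block_mat[of _ 1 1 _ m _ m])
  have "transpose_mat L * (C * L) = four_block_mat (unary_form a) (0\<^sub>m 1 m) (0\<^sub>m m 1) D"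
    unfolding CL LT
    by (subst mult_four_block_mat[of _ 1 1 _ m _ m])
      (use W D r unary_form_carrier[of a] ra in auto)
  also have "\<dots> = orth_sum (unary_form a) D"
    using D by (simp add: orth_sum_four_block unary_form_def)
  finally have eq: "orth_sum (unary_form a) D = transpose_mat L * (C * L)" by simp
  have L: "L \<in> carrier_mat (Suc m) (Suc m)"
    using four_block_carrier_mat[of "1\<^sub>m 1" 1 1 "1\<^sub>m m" m m r "0\<^sub>m m 1"] unfolding L_def by simp
  have "det L = 1"
    unfolding L_def by (subst det_four_block_mat_lower_left_zero[OF _ r]) auto
  moreover have "transpose_mat L * (C * L) = transpose_mat L * C * L" using C L by auto
  ultimately have "isometric C (orth_sum (unary_form a) D)"
    unfolding isometric_def using L C eq by (intro bexI[of _ L]) auto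
  with D show ?thesis by blast
qed

text \<open>A nonzero vector extends to a basis; the matrix with these columns has full rank, hence
  nonzero determinant.\<close>

lemma exists_invertible_first_col:
  fixes v :: "'a::field vec"
  assumes v: "v \<in> carrier_vec n" "v \<noteq> 0\<^sub>v n"
  obtains P where "P \<in> carrier_mat n n" "det P \<noteq> 0" "col P 0 = v"
proof -
  interpret vec_space "TYPE('a)" n .
  let ?b = "basis_completion v"
  note b = basis_completion[OF v]
  let ?P = "mat_of_cols n ?b"
  have P: "?P \<in> carrier_mat n n" using b(6) by (metis mat_of_cols_carrier(1))
  have cols: "cols ?P = ?b" using b(2) by (simp add: cols_mat_of_cols)
  have "rank ?P = n" using lin_indpt_full_rank[OF P] b cols by simp
  then have "det ?P \<noteq> 0" using det_rank_iff[OF P] by simp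
  moreover have "n \<noteq> 0" using v by auto
  then have "col ?P 0 = v" using b(6,7) b(2) by (cases ?b) (auto simp: col_mat_of_cols)
  ultimately show ?thesis using that P by blast
qed

lemma form_value_unit_vec:
  "A \<in> carrier_mat n n \<Longrightarrow> i < n \<Longrightarrow> form_value A (unit_vec n i) = A $$ (i, i)"
  by (simp add: form_value_def scalar_prod_left_unit[of _ n])

text \<open>In a basis that starts with \<open>v\<close>, the corner entry of the Gram matrix is the
  value at \<open>v\<close>. Being nonzero, it serves as pivot for the Schur complement.\<close>

lemma split_off_value:
  fixes A :: "'a::field mat"
  assumes A: "regular_form n A" and v: "v \<in> carrier_vec n" "form_value A v = a" and a: "a \<noteq> 0"
  obtains m B where "n = Suc m" "regular_form m B" "isometric A (orth_sum (unary_form a) B)"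
proof -
  have "v \<noteq> 0\<^sub>v n" using form_value_zero[of A n] A v a by (auto simp: regular_form_def)
  then obtain P where P: "P \<in> carrier_mat n n" "det P \<noteq> 0" "col P 0 = v"
    using exists_invertible_first_col v by blast
  have "n \<noteq> 0" using \<open>v \<noteq> 0\<^sub>v n\<close> v by auto
  then obtain m where n: "n = Suc m" by (cases n) auto
  let ?C = "transpose_mat P * A * P"
  have iso: "isometric A ?C" using P A unfolding isometric_def regular_form_def by auto
  then have C: "regular_form n ?C" using regular_isometric A by blast
  have "?C $$ (0, 0) = form_value ?C (unit_vec n 0)"
    using form_value_unit_vec[OF regular_form_carrier[OF C]] n by simp
  also have "\<dots> = form_value A (P *\<^sub>v unit_vec n 0)"
    using P A by (subst form_value_congruence[of _ n]) (auto simp: regular_form_def)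
  also have "P *\<^sub>v unit_vec n 0 = v" using P n by (intro eq_vecI) auto
  finally have "?C $$ (0, 0) = a" using v by simp
  then obtain D where D: "D \<in> carrier_mat m m" "isometric ?C (orth_sum (unary_form a) D)"
    using schur_complement[of ?C m a] C n a by (auto simp: regular_form_def simp del: assoc_mult_mat)
  have "regular_form (1 + m) (orth_sum (unary_form a) D)" using regular_isometric[OF D(2) C] n by simp
  then have "regular_form m D" using regular_orth_sumD D(1) unary_form_carrier by blast
  then show ?thesis using that n isometric_trans[OF iso D(2) A] by blast
qed

section \<open>Anisotropic and isotropic forms\<close>

lemma anisotropic_iff:
  assumes "A \<in> carrier_mat n n"
  shows "anisotropic A \<longleftrightarrow> (\<forall>v \<in> carrier_vec n. form_value A v = 0 \<longrightarrow> v = 0\<^sub>v n)"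
  using assms by (auto simp: anisotropic_def)

lemma mult_mat_vec_eq_0:
  fixes P :: "'a::field mat"
  assumes "P \<in> carrier_mat n n" "det P \<noteq> 0" "v \<in> carrier_vec n" "P *\<^sub>v v = 0\<^sub>v n"
  shows "v = 0\<^sub>v n"
  using det_0_iff_vec_prod_zero_field[OF assms(1)] assms by blast

lemma anisotropic_isometric:
  assumes "isometric A B" "regular_form n A" "anisotropic A"
  shows "anisotropic B"
proof -
  obtain P where P: "P \<in> carrier_mat n n" "det P \<noteq> 0"
    "\<And>v. v \<in> carrier_vec n \<Longrightarrow> form_value A (P *\<^sub>v v) = form_value B v"
    using isometricE[OF assms(1,2)] by metis
  have "B \<in> carrier_mat n n" using regular_isometric[OF assms(1,2)] by (rule regular_form_carrier)
  moreover have "v = 0\<^sub>v n" if "v \<in> carrier_vec n" "form_value B v = 0" for v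
    using P that assms(3) anisotropic_iff[OF regular_form_carrier[OF assms(2)]]
    by (metis mult_mat_vec_carrier mult_mat_vec_eq_0)
  ultimately show ?thesis by (simp add: anisotropic_iff)
qed

lemma zero_append_vec: "0\<^sub>v n @\<^sub>v 0\<^sub>v m = 0\<^sub>v (n + m)"
  by (intro eq_vecI) auto

lemma anisotropic_orth_sumD:
  assumes "anisotropic (orth_sum A B)" "A \<in> carrier_mat n n" "B \<in> carrier_mat m m"
  shows "anisotropic A" "anisotropic B"
proof -
  have AB: "orth_sum A B \<in> carrier_mat (n + m) (n + m)" using assms by (auto simp: orth_sum_four_block)
  have *: "v = 0\<^sub>v n \<and> w = 0\<^sub>v m"
    if "v \<in> carrier_vec n" "w \<in> carrier_vec m" "form_value A v + form_value B w = 0" for v w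
  proof -
    have "v @\<^sub>v w = 0\<^sub>v n @\<^sub>v 0\<^sub>v m"
      using assms that AB by (simp add: anisotropic_iff form_value_orth_sum zero_append_vec)
    then show ?thesis using that append_vec_eq[of v n "0\<^sub>v n" w "0\<^sub>v m"] by simp
  qed
  show "anisotropic A" using *[of _ "0\<^sub>v m"] assms by (auto simp: anisotropic_iff form_value_zero)
  show "anisotropic B" using *[of "0\<^sub>v n"] assms by (auto simp: anisotropic_iff form_value_zero)
qed

text \<open>If the unary coordinate x of a zero (y, x) were nonzero, dividing y by x would give a
  vector on which \<open>A\<close> takes the value -b.\<close>

lemma anisotropic_orth_sum_unary:
  assumes "A \<in> carrier_mat n n" "anisotropic A" "b \<noteq> 0"
    and nrep: "\<And>v. v \<in> carrier_vec n \<Longrightarrow> form_value A v \<noteq> - b"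
  shows "anisotropic (orth_sum A (unary_form b))"
proof -
  have AB: "orth_sum A (unary_form b) \<in> carrier_mat (n + 1) (n + 1)"
    using assms(1) unary_form_carrier[of b] by (auto simp: orth_sum_four_block)
  have "z = 0\<^sub>v (n + 1)" if z: "z \<in> carrier_vec (n + 1)" "form_value (orth_sum A (unary_form b)) z = 0" for z
  proof -
    obtain y x where yx: "y \<in> carrier_vec n" "x \<in> carrier_vec 1" "z = y @\<^sub>v x"
      using z(1) by (rule append_vecE)
    have eq: "form_value A y + b * (x $ 0)\<^sup>2 = 0"
      using z(2) yx assms(1) unary_form_carrier[of b] by (simp add: form_value_orth_sum form_value_unary_form)
    have "x $ 0 = 0"
    proof (rule ccontr)
      assume x: "x $ 0 \<noteq> 0"
      have "form_value A y = - (b * (x $ 0)\<^sup>2)" using eq by (simp add: eq_neg_iff_add_eq_0)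
      then have "form_value A ((1 / x $ 0) \<cdot>\<^sub>v y) = (1 / x $ 0)\<^sup>2 * (- (b * (x $ 0)\<^sup>2))"
        using yx assms(1) by (simp add: form_value_smult[of _ n])
      also have "\<dots> = - b" using x by (simp add: field_simps)
      finally show False using nrep[of "(1 / x $ 0) \<cdot>\<^sub>v y"] yx by simp
    qed
    then have "x = 0\<^sub>v 1" using yx by (intro eq_vecI) auto
    moreover have "y = 0\<^sub>v n" using eq \<open>x $ 0 = 0\<close> assms(1,2) yx by (simp add: anisotropic_iff)
    ultimately show ?thesis using yx zero_append_vec by blast
  qed
  then show ?thesis using AB anisotropic_iff by blast
qed

text \<open>By regularity, an isotropic v is not orthogonal to some unit vector e. Along the line t
  v + e the form is affine in t with slope twice the pairing of v and e, which is nonzero, so it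
  takes every value.\<close>

lemma isotropic_represents:
  fixes A :: "'a::field mat"
  assumes two: "(2::'a) \<noteq> 0" and A: "regular_form n A" and "\<not> anisotropic A"
  obtains w where "w \<in> carrier_vec n" "form_value A w = a"
proof -
  have carrier: "A \<in> carrier_mat n n" using A by (rule regular_form_carrier)
  obtain v where v: "v \<in> carrier_vec n" "form_value A v = 0" "v \<noteq> 0\<^sub>v n"
    using assms(3) anisotropic_iff[OF carrier] by blast
  have "A *\<^sub>v v \<noteq> 0\<^sub>v n" using A v mult_mat_vec_eq_0[of A n v] by (auto simp: regular_form_def)
  then obtain i where i: "i < n" "(A *\<^sub>v v) $ i \<noteq> 0"
    using carrier by (metis carrier_vecD eq_vecI index_zero_vec mult_mat_vec_carrier v(1))
  define c where "c = (A *\<^sub>v v) $ i"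
  define t where "t = (a - form_value A (unit_vec n i)) / (2 * c)"
  have "unit_vec n i \<bullet> (A *\<^sub>v v) = c"
    using i v carrier unfolding c_def by (simp add: scalar_prod_left_unit[of _ n])
  then have "v \<bullet> (A *\<^sub>v unit_vec n i) = c"
    using bilinear_comm[of A n v "unit_vec n i"] A v by (simp add: regular_form_def)
  then have "(t \<cdot>\<^sub>v v) \<bullet> (A *\<^sub>v unit_vec n i) = t * c"
    using v carrier by (subst smult_scalar_prod_distrib[of v n]) auto
  then have "form_value A (t \<cdot>\<^sub>v v + unit_vec n i) = form_value A (unit_vec n i) + 2 * (t * c)"
    using form_value_add[of A n "t \<cdot>\<^sub>v v" "unit_vec n i"] A v form_value_smult[of A n v t]
    by (simp add: regular_form_def smult_scalar_prod_distrib[of v n])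
  also have "2 * (t * c) = a - form_value A (unit_vec n i)" using i two by (simp add: t_def c_def)
  also have "form_value A (unit_vec n i) + \<dots> = a" by simp
  finally show ?thesis using that[of "t \<cdot>\<^sub>v v + unit_vec n i"] v by simp
qed

section \<open>Splitting off hyperbolic planes\<close>

lemma hyperbolic_plane_eq: "hyperbolic_plane = orth_sum (unary_form 1) (unary_form (- 1))"
  unfolding hyperbolic_plane_def
  by (intro eq_matI) (auto simp: orth_sum_four_block unary_form_def mat_of_rows_list_def less_2_cases_iff)

lemma regular_hyperbolic_plane: "regular_form 2 (hyperbolic_plane :: 'a::field mat)"
  using regular_orth_sum[OF regular_unary_form regular_unary_form, of 1 "- 1"]
  by (simp add: hyperbolic_plane_eq numeral_2_eq_2)

text \<open>An isotropic form represents 1, which splits off with complement \<open>B\<close>. If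
  \<open>B\<close> is isotropic it represents -1 as well; if it is anisotropic, it must represent
  -1, since otherwise adding <1> would keep it anisotropic. Splitting off <-1> from \<open>B\<close>
  completes the plane.\<close>

lemma isotropic_split_hyperbolic:
  fixes A :: "'a::field mat"
  assumes two: "(2::'a) \<noteq> 0" and A: "regular_form n A" and iso: "\<not> anisotropic A"
  obtains m B where "n = Suc (Suc m)" "regular_form m B" "isometric A (orth_sum hyperbolic_plane B)"
proof -
  obtain v where "v \<in> carrier_vec n" "form_value A v = 1" using isotropic_represents[OF assms] .
  from split_off_value[OF A this]
  obtain m B where B: "n = Suc m" "regular_form m B" "isometric A (orth_sum (unary_form 1) B)" by auto
  have regB: "regular_form (1 + m) (orth_sum (unary_form 1) B)"
    using regular_orth_sum[OF regular_unary_form B(2)] by simp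
  have "\<exists>w \<in> carrier_vec m. form_value B w = - 1"
  proof (cases "anisotropic B")
    case True
    have "\<not> anisotropic (orth_sum (unary_form 1) B)"
      using anisotropic_isometric[OF isometric_sym[OF B(3) A]] regular_isometric[OF B(3) A] iso by blast
    then have "\<not> anisotropic (orth_sum B (unary_form 1))"
      using anisotropic_isometric[OF isometric_orth_sum_comm[OF two B(2) regular_unary_form[of 1]]]
        regular_orth_sum[OF B(2) regular_unary_form[of 1]] by auto
    then show ?thesis
      using anisotropic_orth_sum_unary[OF regular_form_carrier[OF B(2)] True, of 1] by auto
  next
    case False
    then show ?thesis using isotropic_represents[OF two B(2)] by metis
  qed
  then obtain w where "w \<in> carrier_vec m" "form_value B w = - 1" by auto
  from split_off_value[OF B(2) this]
  obtain l C where C: "m = Suc l" "regular_form l C" "isometric B (orth_sum (unary_form (- 1)) C)" by auto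
  have "isometric (orth_sum (unary_form 1) B) (orth_sum (unary_form 1) (orth_sum (unary_form (- 1)) C))"
    using isometric_orth_sum[OF two regular_unary_form[of 1] B(2) isometric_refl[OF regular_unary_form[of 1]] C(3)] by simp
  then have "isometric A (orth_sum hyperbolic_plane C)"
    using isometric_trans[OF B(3) _ A] by (simp add: hyperbolic_plane_eq orth_sum_assoc)
  then show ?thesis using that B C by blast
qed

text \<open>
  With \<open>P\<close> in blocks \<open>p, q, r, S\<close>, restricting to the graph \<open>y \<mapsto> (c q(y), y)\<close> makes both unary
  components equal up to sign, for \<open>c\<close> with \<open>p c + 1 = \<plusminus>c\<close>; they cancel, and \<open>S + c r q\<close> is the isometry.
\<close>

lemma witt_cancellation_unary:
  fixes A B :: "'a::field mat"
  assumes two: "(2::'a) \<noteq> 0" and a: "a \<noteq> 0" and A: "regular_form n A" and B: "regular_form n B"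
    and iso: "isometric (orth_sum (unary_form a) A) (orth_sum (unary_form a) B)"
  shows "isometric A B"
proof -
  have c: "A \<in> carrier_mat n n" "B \<in> carrier_mat n n" using A B by (auto simp: regular_form_def)
  obtain P where P: "P \<in> carrier_mat (1 + n) (1 + n)"
    "\<And>v. v \<in> carrier_vec (1 + n) \<Longrightarrow>
      form_value (orth_sum (unary_form a) A) (P *\<^sub>v v) = form_value (orth_sum (unary_form a) B) v"
    using isometricE[OF iso regular_orth_sum[OF regular_unary_form[OF a] A]] by metis
  obtain p q r S where sp: "split_block P 1 1 = (p, q, r, S)" by (cases "split_block P 1 1") auto
  have "dim_row P = 1 + n" "dim_col P = 1 + n" using P(1) by auto
  note split = split_block[OF sp this]
  have blocks: "p \<in> carrier_mat 1 1" "q \<in> carrier_mat 1 n" "r \<in> carrier_mat n 1" "S \<in> carrier_mat n n"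
    and Peq: "P = four_block_mat p q r S" by (fact split)+
  define p0 where "p0 = p $$ (0, 0)"
  \<comment> \<open>The plus sign asks for c = 1/(1 - p0). For p0 = 1 the minus sign is taken
    instead, giving c = -1/2.\<close>
  obtain c where c2: "(p0 * c + 1)\<^sup>2 = c\<^sup>2"
  proof (cases "p0 = 1")
    case True
    then show ?thesis using two by (intro that[of "- 1 / 2"]) (simp add: field_simps power2_eq_square)
  next
    case False
    then have "p0 * (1 / (1 - p0)) + 1 = 1 / (1 - p0)" by (simp add: field_simps)
    then show ?thesis using that by metis
  qed
  define T where "T = S + c \<cdot>\<^sub>m (r * q)"
  have T: "T \<in> carrier_mat n n" using blocks by (auto simp: T_def)
  show ?thesis
  \<comment> \<open>Only preservation of values remains to be shown; invertibility of
    \<open>T\<close> follows from the regularity of \<open>B\<close>.\<close>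
  proof (rule isometric_regularI[OF two A B T])
    fix y :: "'a vec" assume y: "y \<in> carrier_vec n"
    define x where "x = c \<cdot>\<^sub>v (q *\<^sub>v y)"
    have x: "x \<in> carrier_vec 1" using blocks y by (auto simp: x_def)
    have fst: "p *\<^sub>v x + q *\<^sub>v y = (p0 * c + 1) \<cdot>\<^sub>v (q *\<^sub>v y)"
      using blocks y by (intro eq_vecI) (auto simp: x_def p0_def scalar_prod_def algebra_simps)
    have "c \<cdot>\<^sub>m (r * q) *\<^sub>v y = c \<cdot>\<^sub>v (r *\<^sub>v (q *\<^sub>v y))"
      using blocks y by (intro eq_vecI) (auto simp: scalar_prod_def sum_distrib_left mult.assoc)
    then have "T *\<^sub>v y = S *\<^sub>v y + r *\<^sub>v x"
      using blocks y unfolding T_def x_def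
      by (subst add_mult_distrib_mat_vec[of _ n n]) (auto simp: mult_mat_vec[of _ n 1])
    also have "\<dots> = r *\<^sub>v x + S *\<^sub>v y" using blocks x y by (intro comm_add_vec[of _ n]) auto
    finally have "P *\<^sub>v (x @\<^sub>v y) = ((p0 * c + 1) \<cdot>\<^sub>v (q *\<^sub>v y)) @\<^sub>v (T *\<^sub>v y)"
      unfolding Peq using four_block_mat_mult_vec[OF blocks x y] fst by simp
    moreover have "form_value (orth_sum (unary_form a) A) (((p0 * c + 1) \<cdot>\<^sub>v (q *\<^sub>v y)) @\<^sub>v (T *\<^sub>v y))
      = a * ((p0 * c + 1) * (q *\<^sub>v y) $ 0)\<^sup>2 + form_value A (T *\<^sub>v y)"
      using blocks c T y unary_form_carrier[of a]
      by (subst form_value_orth_sum[of _ 1 _ n]) (auto simp: form_value_unary_form)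
    moreover have "form_value (orth_sum (unary_form a) B) (x @\<^sub>v y)
      = a * (c * (q *\<^sub>v y) $ 0)\<^sup>2 + form_value B y"
      using blocks \<open>B \<in> carrier_mat n n\<close> x y unary_form_carrier[of a]
      by (subst form_value_orth_sum[of _ 1 _ n]) (auto simp: form_value_unary_form x_def)
    ultimately show "form_value A (T *\<^sub>v y) = form_value B y"
      using P(2)[OF append_carrier_vec[OF x y]] c2 by (simp add: power_mult_distrib)
  qed
qed

section \<open>The Witt index\<close>

text \<open>Names the shape that occurs in \<open>witt_index\<close>, so that planes can be peeled
  off recursively.\<close>

definition hyperbolic_sum :: "nat \<Rightarrow> 'a::field mat \<Rightarrow> 'a mat" where
  "hyperbolic_sum m B = diag_block_mat (replicate m hyperbolic_plane @ [B])"

lemma hyperbolic_sum_0: "hyperbolic_sum 0 B = B"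
  unfolding hyperbolic_sum_def replicate.simps append.simps by (rule diag_block_mat_singleton)

lemma hyperbolic_sum_Suc: "hyperbolic_sum (Suc m) B = orth_sum hyperbolic_plane (hyperbolic_sum m B)"
  unfolding hyperbolic_sum_def orth_sum_four_block replicate.simps append.simps
    diag_block_mat.simps(2)[of hyperbolic_plane] Let_def ..

lemma hyperbolic_sum_orth_sum: "orth_sum (hyperbolic_sum m B) C = hyperbolic_sum m (orth_sum B C)"
  by (induction m) (simp_all add: hyperbolic_sum_0 hyperbolic_sum_Suc orth_sum_assoc)

text \<open>Lets a plane that arises next to the anisotropic part join the planes already split
  off.\<close>

lemma hyperbolic_sum_Suc_right: "hyperbolic_sum m (orth_sum hyperbolic_plane B) = hyperbolic_sum (Suc m) B"
  by (induction m) (simp_all add: hyperbolic_sum_0 hyperbolic_sum_Suc)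

lemma regular_hyperbolic_sum: "regular_form n B \<Longrightarrow> regular_form (2 * m + n) (hyperbolic_sum m B)"
  by (induction m) (use regular_orth_sum[OF regular_hyperbolic_plane] in
    \<open>auto simp: hyperbolic_sum_0 hyperbolic_sum_Suc\<close>)

lemma isometric_hyperbolic_sum:
  fixes B C :: "'a::field mat"
  assumes two: "(2::'a) \<noteq> 0" and B: "regular_form n B" and "isometric B C"
  shows "isometric (hyperbolic_sum m B) (hyperbolic_sum m C)"
proof (induction m)
  case (Suc m)
  show ?case unfolding hyperbolic_sum_Suc
    by (rule isometric_orth_sum[OF two regular_hyperbolic_plane regular_hyperbolic_sum[OF B]
          isometric_refl[OF regular_hyperbolic_plane] Suc])
qed (simp add: hyperbolic_sum_0 assms)

lemma regular_form_dim_unique: "regular_form n A \<Longrightarrow> regular_form m A \<Longrightarrow> n = m"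
  by (auto simp: regular_form_def)

lemma not_anisotropic_hyperbolic_plane: "\<not> anisotropic (hyperbolic_plane :: 'a::field mat)"
proof
  assume "anisotropic (hyperbolic_plane :: 'a mat)"
  \<comment> \<open>This is the vector (1, 1), a zero of x^2 - y^2.\<close>
  moreover define v :: "'a vec" where "v = unit_vec 1 0 @\<^sub>v unit_vec 1 0"
  have "form_value hyperbolic_plane v = 0"
    unfolding v_def hyperbolic_plane_eq
    by (subst form_value_orth_sum[OF unary_form_carrier unary_form_carrier])
      (auto simp: form_value_unary_form simp del: One_nat_def)
  moreover have "v \<in> carrier_vec (1 + 1)" unfolding v_def by (intro append_carrier_vec unit_vec_carrier)
  then have "v \<in> carrier_vec 2" by (simp only: one_add_one)
  ultimately have "v = 0\<^sub>v 2"
    using anisotropic_iff[OF regular_form_carrier[OF regular_hyperbolic_plane]] by blast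
  then have "v $ 0 = 0" by simp
  then show False by (simp add: v_def)
qed

section \<open>Uniqueness and existence of the Witt decomposition\<close>

text \<open>The plane is <1> plus <-1>, so unary cancellation is applied twice.\<close>

lemma witt_cancellation_hyperbolic:
  fixes A B :: "'a::field mat"
  assumes two: "(2::'a) \<noteq> 0" and A: "regular_form n A" and B: "regular_form n B"
    and iso: "isometric (orth_sum hyperbolic_plane A) (orth_sum hyperbolic_plane B)"
  shows "isometric A B"
proof -
  have reg: "regular_form (1 + n) (orth_sum (unary_form (- 1)) X)" if "regular_form n X" for X :: "'a mat"
    using regular_orth_sum[OF regular_unary_form[of "- 1"] that] by simp
  have "isometric (orth_sum (unary_form (- 1)) A) (orth_sum (unary_form (- 1)) B)"
    using iso witt_cancellation_unary[OF two _ reg[OF A] reg[OF B], of 1]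
    by (simp add: hyperbolic_plane_eq orth_sum_assoc)
  then show ?thesis using witt_cancellation_unary[OF two _ A B, of "- 1"] by simp
qed

text \<open>Planes are cancelled in pairs. Once one side has none left it is anisotropic, so the
  other side cannot contain a plane either.\<close>

lemma hyperbolic_sum_index_unique:
  fixes B C :: "'a::field mat"
  assumes two: "(2::'a) \<noteq> 0" and B: "regular_form b B" "anisotropic B"
    and C: "regular_form c C" "anisotropic C"
    and "isometric (hyperbolic_sum m B) (hyperbolic_sum l C)"
  shows "m = l"
  using assms(6)
proof (induction m arbitrary: l)
  have aniso: False if "anisotropic (hyperbolic_sum (Suc l) X)" "regular_form x X" for l x and X :: "'a mat"
    using anisotropic_orth_sumD(1)[OF that(1)[unfolded hyperbolic_sum_Suc]]
      regular_form_carrier[OF regular_hyperbolic_plane]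
      regular_form_carrier[OF regular_hyperbolic_sum[OF that(2)]] not_anisotropic_hyperbolic_plane by blast
  {
    case 0
    then have "anisotropic (hyperbolic_sum l C)"
      using anisotropic_isometric[OF _ B] by (simp add: hyperbolic_sum_0)
    then show ?case using aniso C(1) by (cases l) auto
  next
    case (Suc m)
    note reg = regular_hyperbolic_sum[OF B(1)] regular_hyperbolic_sum[OF C(1)]
    show ?case
    proof (cases l)
      case 0
      then have "anisotropic (hyperbolic_sum (Suc m) B)"
        using anisotropic_isometric[OF isometric_sym[OF Suc.prems reg(1)]]
          regular_isometric[OF Suc.prems reg(1)] C(2) by (simp add: hyperbolic_sum_0)
      then show ?thesis using aniso B(1) by blast
    next
      case (Suc l')
      \<comment> \<open>Cancellation requires remainders of equal dimension. Since \<open>b\<close>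
        and \<open>c\<close> are not known to agree, this is obtained by comparing total
        dimensions.\<close>
      have "2 * Suc m + b = 2 * l + c"
        using regular_isometric[OF Suc.prems reg(1)] reg(2) regular_form_dim_unique by blast
      then have "2 * m + b = 2 * l' + c" using Suc by simp
      then have "isometric (hyperbolic_sum m B) (hyperbolic_sum l' C)"
        using witt_cancellation_hyperbolic[OF two reg(1)[of m]] reg(2)[of l'] Suc.prems
        by (simp add: hyperbolic_sum_Suc Suc)
      then show ?thesis using Suc.IH Suc by blast
    qed
  }
qed

text \<open>Induction on the dimension: as long as the form is isotropic, a plane splits off and the
  dimension drops by two.\<close>

lemma witt_decomposition:
  fixes A :: "'a::field mat"
  assumes two: "(2::'a) \<noteq> 0" and "regular_form n A"
  shows "\<exists>m b B. regular_form b B \<and> anisotropic B \<and> isometric A (hyperbolic_sum m B)"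
  using assms(2)
proof (induction n arbitrary: A rule: less_induct)
  case (less n)
  show ?case
  proof (cases "anisotropic A")
    case True
    then show ?thesis using less.prems isometric_refl hyperbolic_sum_0 by metis
  next
    case False
    then obtain k C where C: "n = Suc (Suc k)" "regular_form k C" "isometric A (orth_sum hyperbolic_plane C)"
      using isotropic_split_hyperbolic[OF two less.prems] by metis
    then obtain m b B where B: "regular_form b B" "anisotropic B" "isometric C (hyperbolic_sum m B)"
      using less.IH[of k C] by auto
    have "isometric (orth_sum hyperbolic_plane C) (hyperbolic_sum (Suc m) B)"
      unfolding hyperbolic_sum_Suc
      by (rule isometric_orth_sum[OF two regular_hyperbolic_plane C(2) isometric_refl[OF regular_hyperbolic_plane] B(3)])
    then show ?thesis using B isometric_trans[OF C(3) _ less.prems] by blast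
  qed
qed

text \<open>Turns the definite description into a usable rule: any decomposition computes the index,
  because two decompositions of \<open>A\<close> are isometric and hence have equally many
  planes.\<close>

lemma witt_index_eqI:
  fixes A B :: "'a::field mat"
  assumes two: "(2::'a) \<noteq> 0" and A: "regular_form n A" and B: "regular_form b B" "anisotropic B"
    and iso: "isometric A (hyperbolic_sum m B)"
  shows "witt_index A = m"
  unfolding witt_index_def
proof (rule the_equality)
  show "\<exists>n B. regular_form n B \<and> anisotropic B \<and> isometric A (diag_block_mat (replicate m hyperbolic_plane @ [B]))"
    using B iso unfolding hyperbolic_sum_def by blast
  fix l
  assume "\<exists>n C. regular_form n C \<and> anisotropic C \<and> isometric A (diag_block_mat (replicate l hyperbolic_plane @ [C]))"
  then obtain c C where C: "regular_form c C" "anisotropic C" "isometric A (hyperbolic_sum l C)"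
    unfolding hyperbolic_sum_def by blast
  have "isometric (hyperbolic_sum l C) (hyperbolic_sum m B)"
    using isometric_trans[OF isometric_sym[OF C(3) A] iso regular_isometric[OF C(3) A]] .
  then show "l = m" using hyperbolic_sum_index_unique[OF two C(1,2) B] by blast
qed

lemma witt_index_decomposition:
  fixes A :: "'a::field mat"
  assumes two: "(2::'a) \<noteq> 0" and A: "regular_form n A"
  obtains b B where "regular_form b B" "anisotropic B" "isometric A (hyperbolic_sum (witt_index A) B)"
    "n = 2 * witt_index A + b"
proof -
  obtain m b B where B: "regular_form b B" "anisotropic B" "isometric A (hyperbolic_sum m B)"
    using witt_decomposition[OF assms] by blast
  then have "witt_index A = m" using witt_index_eqI[OF two A] by blast
  moreover have "n = 2 * m + b"
    using regular_form_dim_unique[OF regular_isometric[OF B(3) A] regular_hyperbolic_sum[OF B(1)]] .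
  ultimately show ?thesis using that B by blast
qed

section \<open>Keeping the Witt index small while adding forms\<close>

text \<open>If the index \<open>w\<close> is j - 1, the dimension bound prevents the anisotropic
  part \<open>B\<close> from being universal; the negative of a missed value is added, and the index
  stays. If \<open>w\<close> is smaller, <1> may be added: the index then grows by at most
  one.\<close>

lemma exists_unary_witt_index_less:
  fixes A :: "'a::field mat"
  assumes two: "(2::'a) \<noteq> 0" and A: "regular_form n A" and w: "witt_index A < j"
    and no_univ: "\<And>d (B :: 'a mat). \<lbrakk>regular_form d B; anisotropic B; universal B\<rbrakk> \<Longrightarrow> n + 2 < d + 2 * j"
  obtains a where "a \<noteq> 0" "witt_index (orth_sum A (unary_form a)) < j"
proof -
  define w where "w = witt_index A"
  obtain b B where B: "regular_form b B" "anisotropic B" "isometric A (hyperbolic_sum w B)" "n = 2 * w + b"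
    using witt_index_decomposition[OF two A] unfolding w_def by metis
  have wj: "w < j" using w w_def by simp
  note reg = regular_orth_sum[OF _ regular_unary_form]
  have iso: "isometric (orth_sum A (unary_form a)) (hyperbolic_sum w (orth_sum B (unary_form a)))" if "a \<noteq> 0" for a
    using isometric_orth_sum[OF two A regular_unary_form[OF that] B(3) isometric_refl[OF regular_unary_form[OF that]]]
    by (simp add: hyperbolic_sum_orth_sum)
  have nrep: "witt_index (orth_sum A (unary_form a)) = w"
    if "a \<noteq> 0" "\<And>v. v \<in> carrier_vec b \<Longrightarrow> form_value B v \<noteq> - a" for a
    using witt_index_eqI[OF two reg[OF A that(1)] reg[OF B(1) that(1)] _ iso[OF that(1)]]
      anisotropic_orth_sum_unary[OF regular_form_carrier[OF B(1)] B(2) that] by blast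
  show ?thesis
  proof (cases "Suc w < j")
    case False
    \<comment> \<open>Here w = j - 1, so n + 2 = b + 2 j, and \<open>no_univ\<close> applied to
      \<open>B\<close> would be a strict inequality between equal numbers.\<close>
    then have "\<not> universal B" using no_univ[OF B(1,2)] B(4) wj by auto
    then obtain a where "a \<noteq> 0" "\<And>v. v \<in> carrier_vec b \<Longrightarrow> form_value B v \<noteq> a"
      using regular_form_carrier[OF B(1)] unfolding universal_def by auto
    then show ?thesis using that[of "- a"] nrep[of "- a"] wj by simp
  next
    case True
    show ?thesis
    proof (cases "\<exists>v \<in> carrier_vec b. form_value B v = - 1")
      case False
      then show ?thesis using that[of 1] nrep[of 1] wj by auto
    next
      case True
      then obtain v where "v \<in> carrier_vec b" "form_value B v = - 1" by blast
      from split_off_value[OF B(1) this]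
      obtain c C where C: "b = Suc c" "regular_form c C" "isometric B (orth_sum (unary_form (- 1)) C)" by auto
      note u1 = regular_unary_form[of "1::'a"] and u2 = regular_unary_form[of "- 1::'a"]
      have regC: "regular_form b (orth_sum (unary_form (- 1)) C)" using regular_isometric[OF C(3) B(1)] .
      have "anisotropic (orth_sum (unary_form (- 1)) C)" using anisotropic_isometric[OF C(3) B(1,2)] .
      then have anC: "anisotropic C"
        using anisotropic_orth_sumD(2) unary_form_carrier regular_form_carrier[OF C(2)] by blast
      have "isometric (orth_sum B (unary_form 1)) (orth_sum (unary_form 1) B)"
        using isometric_orth_sum_comm[OF two B(1) u1] by simp
      moreover have "isometric (orth_sum (unary_form 1) B) (orth_sum hyperbolic_plane C)"
        using isometric_orth_sum[OF two u1 B(1) isometric_refl[OF u1] C(3)]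
        by (simp add: hyperbolic_plane_eq orth_sum_assoc)
      ultimately have "isometric (orth_sum B (unary_form 1)) (orth_sum hyperbolic_plane C)"
        using isometric_trans reg[OF B(1), of 1] by auto
      then have "isometric (hyperbolic_sum w (orth_sum B (unary_form 1))) (hyperbolic_sum (Suc w) C)"
        using isometric_hyperbolic_sum[OF two reg[OF B(1), of 1], of _ w]
        by (simp add: hyperbolic_sum_Suc_right[symmetric])
      then have "isometric (orth_sum A (unary_form 1)) (hyperbolic_sum (Suc w) C)"
        using isometric_trans[OF iso[of 1]] reg[OF A, of 1] by auto
      \<comment> \<open>The new <1> pairs with the <-1> inside \<open>B\<close>; the complement
        \<open>C\<close> is still anisotropic, so exactly one plane is gained.\<close>
      then have "witt_index (orth_sum A (unary_form 1)) = Suc w"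
        using witt_index_eqI[OF two reg[OF A, of 1] C(2) anC] by simp
      then show ?thesis using that[of 1] \<open>Suc w < j\<close> by simp
    qed
  qed
qed

text \<open>The forms are added one dimension at a time. Each step moves one unit from
  \<open>i\<close> to \<open>n\<close>, so the bound on n + i is preserved; while i is positive it
  implies the bound n + 2 < d + 2 j required for a unary step.\<close>

lemma exists_orth_sum_witt_index_less:
  fixes A :: "'a::field mat"
  assumes two: "(2::'a) \<noteq> 0" and "regular_form n A" "witt_index A < j"
    and "\<And>d (B :: 'a mat). \<lbrakk>regular_form d B; anisotropic B; universal B\<rbrakk> \<Longrightarrow> n + i + 1 < d + 2 * j"
  shows "\<exists>S :: 'a mat. regular_form i S \<and> witt_index (orth_sum A S) < j"
  using assms(2-)
proof (induction i arbitrary: n A)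
  case 0
  \<comment> \<open>The only form of dimension 0 is the empty matrix, which is regular because its
    determinant is 1.\<close>
  have "orth_sum A (0\<^sub>m 0 0) = A" by (intro eq_matI) (auto simp: orth_sum_four_block)
  moreover have "regular_form 0 (0\<^sub>m 0 0 :: 'a mat)" by (simp add: regular_form_def det_dim_zero)
  ultimately show ?case using 0 by metis
next
  case (Suc i)
  have "n + 2 < d + 2 * j" if "regular_form d B" "anisotropic B" "universal B" for d and B :: "'a mat"
    using Suc.prems(3)[OF that] by simp
  then obtain a where a: "a \<noteq> 0" "witt_index (orth_sum A (unary_form a)) < j"
    by (rule exists_unary_witt_index_less[OF two Suc.prems(1,2)])
  have "\<exists>S :: 'a mat. regular_form i S \<and> witt_index (orth_sum (orth_sum A (unary_form a)) S) < j"
    using Suc.prems(3) by (intro Suc.IH[OF regular_orth_sum[OF Suc.prems(1) regular_unary_form[OF a(1)]] a(2)]) simp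
  then obtain S :: "'a mat" where "regular_form i S" "witt_index (orth_sum (orth_sum A (unary_form a)) S) < j"
    by blast
  then have "regular_form (Suc i) (orth_sum (unary_form a) S)"
    "witt_index (orth_sum A (orth_sum (unary_form a) S)) < j"
    using regular_orth_sum[OF regular_unary_form[OF a(1)]] by (auto simp: orth_sum_assoc)
  then show ?case by blast
qed

text \<open>Descending induction: an anisotropic form of positive dimension has a nonzero value at
  the first unit vector, and the complement of that value is again anisotropic.\<close>

lemma exists_anisotropic_smaller:
  fixes A :: "'a::field mat"
  assumes "regular_form n A" "anisotropic A" "d \<le> n"
  shows "\<exists>B :: 'a mat. regular_form d B \<and> anisotropic B"
  using assms(3)
proof (induction rule: inc_induct)
  case base
  then show ?case using assms by blast
next
  case (step l)
  then obtain B :: "'a mat" where B: "regular_form (Suc l) B" "anisotropic B" by blast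
  have "unit_vec (Suc l) 0 \<noteq> (0\<^sub>v (Suc l) :: 'a vec)" by (simp add: unit_vec_nonzero)
  then have "form_value B (unit_vec (Suc l) 0) \<noteq> 0"
    using B anisotropic_iff[OF regular_form_carrier[OF B(1)]] by auto
  from split_off_value[OF B(1) _ refl this]
  obtain C where C: "regular_form l C" "isometric B (orth_sum (unary_form (form_value B (unit_vec (Suc l) 0))) C)"
    by auto
  then have "anisotropic C"
    using anisotropic_orth_sumD(2)[OF anisotropic_isometric[OF C(2) B]] unary_form_carrier regular_form_carrier by blast
  with C show ?case by blast
qed

section \<open>The invariants\<close>

lemma anisotropic_unary_form: "a \<noteq> 0 \<Longrightarrow> anisotropic (unary_form a)"
  by (auto simp: anisotropic_iff[OF unary_form_carrier] form_value_unary_form intro!: eq_vecI)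

text \<open>A nonempty set of extended naturals with finite supremum is finite and has a maximum.
  The form <1> provides nonemptiness and U >= 1.\<close>

lemma u_invariant_attained:
  assumes "u_invariant (k :: 'a::field itself) < \<infinity>"
  obtains U where "u_invariant k = enat U" "U \<ge> 1" "\<exists>A :: 'a mat. regular_form U A \<and> anisotropic A"
    "\<And>n (A :: 'a mat). regular_form n A \<Longrightarrow> anisotropic A \<Longrightarrow> n \<le> U"
proof -
  define D where "D = {enat n | n. \<exists>A :: 'a mat. regular_form n A \<and> anisotropic A}"
  have u: "u_invariant k = Sup D" by (simp add: u_invariant_def D_def)
  have "regular_form 1 (unary_form (1::'a)) \<and> anisotropic (unary_form (1::'a))"
    by (simp add: regular_unary_form anisotropic_unary_form del: One_nat_def)
  then have "enat 1 \<in> D" unfolding D_def by (intro CollectI exI[of _ 1] conjI refl) (rule exI)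
  then have "finite D" "D \<noteq> {}" using assms unfolding u Sup_enat_def by (auto split: if_splits)
  then have "Sup D \<in> D" unfolding Sup_enat_def by simp
  then obtain U where U: "Sup D = enat U" "\<exists>A :: 'a mat. regular_form U A \<and> anisotropic A"
    unfolding D_def by auto
  have ub: "n \<le> U" if "enat n \<in> D" for n
    using Sup_upper[OF that] U by simp
  show ?thesis
  proof (rule that[of U])
    show "1 \<le> U" using ub \<open>enat 1 \<in> D\<close> .
    show "n \<le> U" if "regular_form n A" "anisotropic A" for n and A :: "'a mat"
      using ub that unfolding D_def by blast
  qed (use u U in auto)
qed

section \<open>Upper and lower bounds for the general invariant\<close>

text \<open>The witness consists of \<open>t\<close> hyperbolic planes and an anisotropic form of
  dimension n - 2 t; such a form exists because a maximal anisotropic form can be shrunk.\<close>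

lemma general_m_invariant_le:
  fixes k :: "'a::field itself"
  assumes two: "(2::'a) \<noteq> 0" and A: "regular_form U (A :: 'a mat)" "anisotropic A" and "U \<ge> 1" "i \<ge> 1" "j \<ge> 1"
    and max: "\<And>n (A :: 'a mat). regular_form n A \<Longrightarrow> anisotropic A \<Longrightarrow> n \<le> U"
  shows "general_m_invariant k i j \<le> enat (Max {1, U + 2 * j - 1 - i})"
proof -
  \<comment> \<open>Subtraction on \<open>nat\<close> truncates at 0, but the maximum with 1 absorbs
    the difference.\<close>
  define n where "n = Max {1, U + 2 * j - 1 - i}"
  \<comment> \<open>The least number of planes that leaves a remainder of dimension at most
    \<open>U\<close>: half of n - U, rounded up, and 0 when n \<le> U.\<close>
  define t where "t = (n - U + 1) div 2"
  have n: "n \<ge> 1" "U + 2 * j \<le> n + i + 1" "n \<le> U + 2 * (j - 1)"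
    using assms(4-6) by (auto simp: n_def)
  then have t: "t < j" "2 * t \<le> n" "n - 2 * t \<le> U" using assms(4,6) unfolding t_def by auto
  then obtain B :: "'a mat" where B: "regular_form (n - 2 * t) B" "anisotropic B"
    using exists_anisotropic_smaller[OF A] by blast
  have reg: "regular_form n (hyperbolic_sum t B)" using regular_hyperbolic_sum[OF B(1), of t] t by simp
  moreover have "witt_index (hyperbolic_sum t B) < j"
    using witt_index_eqI[OF two reg B isometric_refl[OF reg]] t by simp
  moreover have "witt_index (orth_sum (hyperbolic_sum t B) S) \<ge> j" if S: "regular_form i S" for S
  proof -
    obtain c and C :: "'a mat" where "regular_form c C" "anisotropic C" "n + i = 2 * witt_index (orth_sum (hyperbolic_sum t B) S) + c"
      using witt_index_decomposition[OF two regular_orth_sum[OF reg S]] by metis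
    \<comment> \<open>From n + i \<ge> U + 2 j - 1 and c \<le> U, twice the index is at least 2 j -
      1; as the index is an integer, it is at least \<open>j\<close>.\<close>
    then show ?thesis using max[of c C] n(2) by linarith
  qed
  ultimately have "enat n \<in> {enat n | n. n \<ge> 1 \<and>
     (\<exists>A :: 'a mat. regular_form n A \<and> witt_index A < j \<and>
        (\<forall>S :: 'a mat. regular_form i S \<longrightarrow> witt_index (orth_sum A S) \<ge> j))}"
    using n(1) by (intro CollectI exI[of _ n] exI[of _ "hyperbolic_sum t B"] conjI refl allI impI)
  then show ?thesis unfolding general_m_invariant_def n_def[symmetric] by (rule Inf_lower)
qed

text \<open>For a form attaining the infimum, no summand of dimension \<open>i\<close> keeps the
  index below \<open>j\<close>. The hypothesis of \<open>exists_orth_sum_witt_index_less\<close>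
  must therefore fail, and its failure produces an anisotropic universal form of small dimension
  \<open>d\<close>.\<close>

lemma le_general_m_invariant:
  fixes k :: "'a::field itself"
  assumes two: "(2::'a) \<noteq> 0" and g: "general_m_invariant k i j = enat n"
  obtains d where "m_invariant k \<le> enat d" "d + 2 * j \<le> n + i + 1" "n \<ge> 1"
proof -
  let ?G = "{enat n | n. n \<ge> 1 \<and>
     (\<exists>A :: 'a mat. regular_form n A \<and> witt_index A < j \<and>
        (\<forall>S :: 'a mat. regular_form i S \<longrightarrow> witt_index (orth_sum A S) \<ge> j))}"
  have "Inf ?G = enat n" using g by (simp add: general_m_invariant_def)
  \<comment> \<open>A finite infimum of extended naturals comes from a nonempty set and is its least
    element.\<close>
  then have "enat n \<in> ?G" unfolding Inf_enat_def by (metis (no_types, lifting) LeastI_ex enat.distinct(1) ex_in_conv)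
  then obtain A :: "'a mat" where n: "n \<ge> 1" and A: "regular_form n A" "witt_index A < j"
    "\<And>S :: 'a mat. regular_form i S \<Longrightarrow> witt_index (orth_sum A S) \<ge> j" by auto
  obtain d and B :: "'a mat" where B: "regular_form d B" "anisotropic B" "universal B" "\<not> n + i + 1 < d + 2 * j"
    using exists_orth_sum_witt_index_less[OF two A(1,2), of i] A(3) by (meson leD)
  then have "m_invariant k \<le> enat d" unfolding m_invariant_def by (intro Inf_lower) blast
  then show ?thesis using that B(4) n by simp
qed

lemma two_neq_0_if_char: "CHAR('a::field) \<noteq> 2 \<Longrightarrow> (2::'a) \<noteq> 0"
  using of_nat_eq_0_iff_char_dvd[of 2, where 'a = 'a] prime_nat_iff two_is_prime_nat CHAR_not_1' by auto

theorem theorem3p10: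
  fixes k :: "'a::field itself" and i j :: nat
  assumes "CHAR('a) \<noteq> 2"
    and "u_invariant k < \<infinity>"
    and "i \<ge> 1" and "j \<ge> 1"
  shows "max 1 (ereal_of_enat (m_invariant k) + ereal (2 * real j - 1 - real i))
           \<le> ereal_of_enat (general_m_invariant k i j) \<and>
         ereal_of_enat (general_m_invariant k i j)
           \<le> max 1 (ereal_of_enat (u_invariant k) + ereal (2 * real j - 1 - real i)) \<and>
         (ereal_of_enat (u_invariant k) + ereal (2 * real j - 1 - real i) \<le> 1 \<or> m_invariant k = u_invariant k
          \<longrightarrow> max 1 (ereal_of_enat (m_invariant k) + ereal (2 * real j - 1 - real i))
                = ereal_of_enat (general_m_invariant k i j) \<and>
              ereal_of_enat (general_m_invariant k i j)
                = max 1 (ereal_of_enat (u_invariant k) + ereal (2 * real j - 1 - real i)))"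
proof -
  let ?c = "ereal (2 * real j - 1 - real i)"
  have two: "(2::'a) \<noteq> 0" using two_neq_0_if_char assms(1) .
  obtain U where u: "u_invariant k = enat U" "U \<ge> 1" "\<exists>A :: 'a mat. regular_form U A \<and> anisotropic A"
    "\<And>n (A :: 'a mat). regular_form n A \<Longrightarrow> anisotropic A \<Longrightarrow> n \<le> U"
    using u_invariant_attained[OF assms(2)] by metis
  obtain n where n: "general_m_invariant k i j = enat n" and nU: "n \<le> Max {1, U + 2 * j - 1 - i}"
    using general_m_invariant_le[OF two, of U _ i j k] u assms(3,4) by (metis enat_ile enat_ord_simps(1))
  obtain d where d: "m_invariant k \<le> enat d" "d + 2 * j \<le> n + i + 1" "n \<ge> 1"
    using le_general_m_invariant[OF two n] .
  \<comment> \<open>Finiteness of m(k) comes out of the argument here: it is bounded by the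
    dimension \<open>d\<close> of an actual form.\<close>
  obtain m where m: "m_invariant k = enat m" "m \<le> d" using d(1) by (metis enat_ile enat_ord_simps(1))
  have lower: "max 1 (ereal_of_enat (m_invariant k) + ?c) \<le> ereal_of_enat (general_m_invariant k i j)"
    using m d by (auto simp: n)
  have upper: "ereal_of_enat (general_m_invariant k i j) \<le> max 1 (ereal_of_enat (u_invariant k) + ?c)"
  \<comment> \<open>The case condition says that U + 2 j - 1 - i is at least 1, so truncated and
    real subtraction agree; otherwise the maximum on the natural side is 1.\<close>
  proof (cases "i + 2 \<le> U + 2 * j")
    case True
    then have "real n \<le> real U + (2 * real j - 1 - real i)" using nU by (auto simp: max_def split: if_splits)
    then show ?thesis by (simp add: n u max.coboundedI2)
  next
    case False
    then show ?thesis using nU by (simp add: n u max.coboundedI1)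
  qed
  \<comment> \<open>The equalities follow by squeezing: if the upper term is at most 1, the
    invariant lies between 1 and 1, and if m(k) = u(k), the two bounds coincide.\<close>
  show ?thesis
    using lower upper by (auto simp: max_def split: if_splits)
qed

end
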